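(* Let $E$ be a vector lattice, let $F$ be an ideal of $E$, and let $\tau_F$ be a (not necessarily Hausdorff) locally solid additive topology on $F$. Take a non-empty subset $S$ of $F$. Then there exists a unique (possibly non-Hausdorff) additive topology $\mathrm{u}_S\tau_F$ on $E$ such that, for every net $(x_\alpha)_{\alpha\in\mathcal A}$ in $E$, $x_\alpha\to 0$ in $\mathrm{u}_S\tau_F$ if and only if $|x_\alpha|\wedge|s|\to 0$ in $(F,\tau_F)$ for all $s\in S$. Let $I_S\subseteq F$ be the ideal generated by $S$ in $E$. For a net $(x_\alpha)_{\alpha\in\mathcal A}$ in $E$, $x_\alpha\to 0$ in $\mathrm{u}_S\tau_F$ if and only if $|x_\alpha|\wedge|y|\to 0$ in $(F,\tau_F)$ for all $y\in I_S$. Furthermore: (1) the inclusion map from $F$ into $E$ is $\tau_F$-to-$\mathrm{u}_S\tau_F$ continuous; (2) $\mathrm{u}_S\tau_F$ is a locally solid additive topology on $E$; (3) the following are equivalent: (a) $\mathrm{u}_S\tau_F$ is a Hausdorff topology on $E$; (b) $\tau_F$ is a Hausdorff topology on $F$ and $I_S$ is order dense in $E$; (4) the following are equivalent: (a) for all $x\in E$ and $s\in S$, $|\varepsilon x|\wedge|s|\to 0$ in $(F,\tau_F)$ as $\varepsilon\to 0$ in $\mathbb R$; (b) for all $x\in E$ and $y\in I_S$, $|\varepsilon x|\wedge|y|\to 0$ in $(F,\tau_F)$ as $\varepsilon\to 0$ in $\mathbb R$; (c) $\mathrm{u}_S\tau_F$ is a (possibly non-Hausdorff) linear topology on $E$.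
   Context: All vector lattices are real and Archimedean. An additive topology on a vector lattice $E$ is a (not necessarily Hausdorff) topology making the additive group of $E$ a topological group. A locally solid additive topology is an additive topology for which there is a base of (not necessarily open) neighbourhoods of $0$ consisting of solid subsets. A linear topology is a (not necessarily Hausdorff) topology making $E$ a topological vector space. A vector sublattice $F$ of $E$ is order dense in $E$ if for every $x\in E$ with $x>0$ there is $y\in F$ with $0<y\le x$. *)

theory Defs
  imports "HOL-Analysis.Analysis" "HOL-Library.Lattice_Algebras"
begin

section \<open>Vector lattices\<close>

text \<open>The last axiom says that the infimum of \<open>x / n\<close> over \<open>n \<ge> 1\<close> is \<open>0\<close> for all \<open>x \<ge> 0\<close>.\<close>

class archimedean_vector_lattice = ordered_real_vector + lattice_ab_group_add_abs +
  assumes archimedean: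
    "0 \<le> x \<Longrightarrow> (\<And>n::nat. 1 \<le> n \<Longrightarrow> z \<le> (1 / real n) *\<^sub>R x) \<Longrightarrow> z \<le> 0"

definition solid_in :: "'a::archimedean_vector_lattice set \<Rightarrow> 'a set \<Rightarrow> bool" where
  "solid_in F V \<longleftrightarrow> V \<subseteq> F \<and> (\<forall>x\<in>V. \<forall>y\<in>F. \<bar>y\<bar> \<le> \<bar>x\<bar> \<longrightarrow> y \<in> V)"

definition order_ideal :: "'a::archimedean_vector_lattice set \<Rightarrow> bool" where
  "order_ideal I \<longleftrightarrow> subspace I \<and> solid_in UNIV I"

abbreviation generated_ideal :: "'a::archimedean_vector_lattice set \<Rightarrow> 'a set" where
  "generated_ideal S \<equiv> order_ideal hull S"

definition order_dense :: "'a::archimedean_vector_lattice set \<Rightarrow> bool" where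
  "order_dense F \<longleftrightarrow> (\<forall>x>0. \<exists>y\<in>F. 0 < y \<and> y \<le> x)"

section \<open>Group topologies and linear topologies on a carrier\<close>

definition additive_topology_on :: "'a::real_vector set \<Rightarrow> 'a topology \<Rightarrow> bool" where
  "additive_topology_on G \<tau> \<longleftrightarrow>
     topspace \<tau> = G \<and>
     continuous_map (prod_topology \<tau> \<tau>) \<tau> (\<lambda>(x, y). x + y) \<and>
     continuous_map \<tau> \<tau> (\<lambda>x. - x)"

definition locally_solid_additive_topology_on ::
    "'a::archimedean_vector_lattice set \<Rightarrow> 'a topology \<Rightarrow> bool" where
  "locally_solid_additive_topology_on G \<tau> \<longleftrightarrow>
     additive_topology_on G \<tau> \<and>
     (\<forall>U. openin \<tau> U \<and> 0 \<in> U \<longrightarrow>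
        (\<exists>V. solid_in G V \<and> V \<subseteq> U \<and> (\<exists>W. openin \<tau> W \<and> 0 \<in> W \<and> W \<subseteq> V)))"

definition linear_topology_on :: "'a::real_vector set \<Rightarrow> 'a topology \<Rightarrow> bool" where
  "linear_topology_on G \<tau> \<longleftrightarrow>
     topspace \<tau> = G \<and>
     continuous_map (prod_topology \<tau> \<tau>) \<tau> (\<lambda>(x, y). x + y) \<and>
     continuous_map (prod_topology euclideanreal \<tau>) \<tau> (\<lambda>(c, x). c *\<^sub>R x)"

section \<open>Nets\<close>

definition directed_set :: "'i set \<Rightarrow> ('i \<Rightarrow> 'i \<Rightarrow> bool) \<Rightarrow> bool" where
  "directed_set A le \<longleftrightarrow>
     A \<noteq> {} \<and> reflp_on A le \<and> transp_on A le \<and>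
     (\<forall>a\<in>A. \<forall>b\<in>A. \<exists>c\<in>A. le a c \<and> le b c)"

definition tails :: "'i set \<Rightarrow> ('i \<Rightarrow> 'i \<Rightarrow> bool) \<Rightarrow> 'i filter" where
  "tails A le = (INF a\<in>A. principal {b \<in> A. le a b})"

text \<open>A net is a function on a directed set, and its convergence is \<^const>\<open>limitin\<close> along
  the filter of tails, as the next two facts show.\<close>

lemma eventually_tails:
  assumes "directed_set A le"
  shows "eventually P (tails A le) \<longleftrightarrow> (\<exists>a\<in>A. \<forall>b\<in>A. le a b \<longrightarrow> P b)"
proof -
  have "eventually P (tails A le) \<longleftrightarrow>
      (\<exists>a\<in>A. eventually P (principal {b \<in> A. le a b}))"
    unfolding tails_def
  proof (rule eventually_INF_base)
    show "A \<noteq> {}"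
      using assms by (simp add: directed_set_def)
    fix a b assume ab: "a \<in> A" "b \<in> A"
    then obtain c where c: "c \<in> A" "le a c" "le b c"
      using assms unfolding directed_set_def by blast
    have "{d \<in> A. le c d} \<subseteq> {d \<in> A. le a d} \<inter> {d \<in> A. le b d}"
      using assms ab c unfolding directed_set_def by (blast dest: transp_onD)
    then show "\<exists>x\<in>A. principal {d \<in> A. le x d} \<le>
        inf (principal {d \<in> A. le a d}) (principal {d \<in> A. le b d})"
      using c(1) by auto
  qed
  then show ?thesis
    by (auto simp: eventually_principal)
qed

lemma limitin_tails:
  assumes "directed_set A le"
  shows "limitin \<tau> x l (tails A le) \<longleftrightarrow>
    l \<in> topspace \<tau> \<and>
    (\<forall>U. openin \<tau> U \<and> l \<in> U \<longrightarrow> (\<exists>a\<in>A. \<forall>b\<in>A. le a b \<longrightarrow> x b \<in> U))"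
  using assms by (simp add: limitin_def eventually_tails)

section \<open>The unbounded topology\<close>

text \<open>HOL cannot quantify over all index types inside a formula. The nets below have as
  index sets all directed sets of subsets of \<open>'a\<close>. This includes the neighbourhoods of \<open>0\<close>,
  so these nets already determine an additive topology.\<close>

definition is_unbounded_topology ::
    "'a topology \<Rightarrow> 'a set \<Rightarrow> 'a::archimedean_vector_lattice topology \<Rightarrow> bool" where
  "is_unbounded_topology \<tau>F S \<tau> \<longleftrightarrow>
     additive_topology_on UNIV \<tau> \<and>
     (\<forall>(A :: 'a set set) le (x :: 'a set \<Rightarrow> 'a). directed_set A le \<longrightarrow>
        (limitin \<tau> x 0 (tails A le) \<longleftrightarrow>
         (\<forall>s\<in>S. limitin \<tau>F (\<lambda>\<alpha>. inf \<bar>x \<alpha>\<bar> \<bar>s\<bar>) 0 (tails A le))))"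

end

theory Submission
  imports Defs
begin

text \<open>An additive topology is determined by its neighbourhood filter at \<open>0\<close>. The convergence
  condition on nets says that they converge along the initial filter \<open>N\<close> of the maps
  \<open>x \<mapsto> \<bar>x\<bar> \<and> \<bar>s\<bar>\<close> from \<open>E\<close> to the neighbourhood filter of \<open>0\<close> in \<open>F\<close>, and the inequality
  \<open>\<bar>x + y\<bar> \<and> \<bar>s\<bar> \<le> \<bar>x\<bar> \<and> \<bar>s\<bar> + \<bar>y\<bar> \<and> \<bar>s\<bar>\<close> makes \<open>N\<close> the neighbourhood filter of a group topology.
  For a fixed net the \<open>y \<in> F\<close> with \<open>\<bar>x\<^sub>\<alpha>\<bar> \<and> \<bar>y\<bar> \<rightarrow> 0\<close> form an ideal, so \<open>S\<close> and \<open>I\<^sub>S\<close> give the same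
  condition. Local solidity amounts to closure of null nets under domination, Hausdorffness
  is tested on constant nets, and joint continuity of scalar multiplication follows from
  \<open>c x - d a = c (x - a) + (c - d) a\<close>.\<close>

section \<open>Neighbourhood filters\<close>

text \<open>Outside \<open>topspace X\<close> the filter \<open>nhdsin X a\<close> is
  \<open>bot\<close>, along which every property holds eventually; hence the separate
  inclusion.\<close>

lemma openin_iff_eventually_nhdsin:
  "openin X U \<longleftrightarrow> U \<subseteq> topspace X \<and> (\<forall>a\<in>U. eventually (\<lambda>x. x \<in> U) (nhdsin X a))"
proof
  assume "openin X U"
  then show "U \<subseteq> topspace X \<and> (\<forall>a\<in>U. eventually (\<lambda>x. x \<in> U) (nhdsin X a))"
    using openin_subset by (auto simp: eventually_nhdsin)
next
  assume R: "U \<subseteq> topspace X \<and> (\<forall>a\<in>U. eventually (\<lambda>x. x \<in> U) (nhdsin X a))"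
  show "openin X U"
    unfolding openin_subopen[of X U]
  proof
    fix a assume "a \<in> U"
    with R have "a \<in> topspace X" "eventually (\<lambda>x. x \<in> U) (nhdsin X a)"
      by blast+
    then show "\<exists>T. openin X T \<and> a \<in> T \<and> T \<subseteq> U"
      unfolding eventually_nhdsin by blast
  qed
qed

text \<open>Passing to \<open>filterlim\<close> gives access to composition, products and inverse
  images of filters. Membership of \<open>l\<close> again excludes the degenerate filter
  \<open>bot\<close>.\<close>

lemma limitin_iff_filterlim_nhdsin:
  "limitin X f l F \<longleftrightarrow> l \<in> topspace X \<and> filterlim f (nhdsin X l) F"
proof
  assume lim: "limitin X f l F"
  then have l: "l \<in> topspace X"
    by (rule limitin_topspace)
  moreover have "filterlim f (nhdsin X l) F"
    unfolding filterlim_iff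
  proof (intro allI impI)
    fix P assume "eventually P (nhdsin X l)"
    then obtain U where U: "openin X U" "l \<in> U" "\<forall>x\<in>U. P x"
      using l by (auto simp: eventually_nhdsin)
    with lim have "eventually (\<lambda>z. f z \<in> U) F"
      by (simp add: limitin_def)
    then show "eventually (\<lambda>z. P (f z)) F"
      by (rule eventually_mono) (use U(3) in blast)
  qed
  ultimately show "l \<in> topspace X \<and> filterlim f (nhdsin X l) F" ..
next
  assume R: "l \<in> topspace X \<and> filterlim f (nhdsin X l) F"
  have "eventually (\<lambda>z. f z \<in> U) F" if "openin X U" "l \<in> U" for U
  proof -
    have "eventually (\<lambda>x. x \<in> U) (nhdsin X l)"
      using that by (auto simp: eventually_nhdsin)
    from eventually_compose_filterlim[OF this conjunct2[OF R]] show ?thesis .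
  qed
  with R show "limitin X f l F"
    by (simp add: limitin_def)
qed

lemma continuous_map_iff_filterlim:
  "continuous_map X Y f \<longleftrightarrow>
    (\<forall>a\<in>topspace X. f a \<in> topspace Y \<and> filterlim f (nhdsin Y (f a)) (nhdsin X a))"
proof
  assume c: "continuous_map X Y f"
  show "\<forall>a\<in>topspace X. f a \<in> topspace Y \<and> filterlim f (nhdsin Y (f a)) (nhdsin X a)"
  proof (intro ballI conjI)
    fix a assume a: "a \<in> topspace X"
    then show fa: "f a \<in> topspace Y"
      using c by (auto simp: continuous_map_def)
    show "filterlim f (nhdsin Y (f a)) (nhdsin X a)"
      unfolding filterlim_iff
    proof (intro allI impI)
      fix P assume "eventually P (nhdsin Y (f a))"
      then obtain V where "openin Y V" "f a \<in> V" "\<forall>x\<in>V. P x"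
        using fa by (auto simp: eventually_nhdsin)
      moreover have "openin X {x \<in> topspace X. f x \<in> V}"
        using c \<open>openin Y V\<close> by (auto simp: continuous_map_def)
      ultimately show "eventually (\<lambda>x. P (f x)) (nhdsin X a)"
        using a unfolding eventually_nhdsin by blast
    qed
  qed
next
  assume R: "\<forall>a\<in>topspace X. f a \<in> topspace Y \<and> filterlim f (nhdsin Y (f a)) (nhdsin X a)"
  show "continuous_map X Y f"
    unfolding continuous_map_def
  proof (intro conjI allI impI)
    show "f \<in> topspace X \<rightarrow> topspace Y"
      using R by auto
    fix V assume V: "openin Y V"
    have "eventually (\<lambda>x. x \<in> topspace X \<and> f x \<in> V) (nhdsin X a)"
      if "a \<in> topspace X" "f a \<in> V" for a
    proof (rule eventually_conj)
      show "eventually (\<lambda>x. x \<in> topspace X) (nhdsin X a)"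
        using openin_iff_eventually_nhdsin[of X "topspace X"] that by auto
      have "eventually (\<lambda>y. y \<in> V) (nhdsin Y (f a))"
        using V that(2) by (auto simp: eventually_nhdsin)
      then show "eventually (\<lambda>x. f x \<in> V) (nhdsin X a)"
        using R that(1) by (auto simp: filterlim_iff)
    qed
    then show "openin X {x \<in> topspace X. f x \<in> V}"
      by (auto simp: openin_iff_eventually_nhdsin)
  qed
qed

text \<open>Open rectangles form a base, so joint continuity of addition and of scalar
  multiplication turns into limits along product filters.\<close>

lemma nhdsin_prod_topology:
  assumes "a \<in> topspace X" "b \<in> topspace Y"
  shows "nhdsin (prod_topology X Y) (a, b) = nhdsin X a \<times>\<^sub>F nhdsin Y b"
proof (rule filter_eqI)
  fix P
  show "eventually P (nhdsin (prod_topology X Y) (a, b)) \<longleftrightarrow>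
      eventually P (nhdsin X a \<times>\<^sub>F nhdsin Y b)" (is "?L \<longleftrightarrow> ?R")
  proof
    assume ?L
    then obtain W where W: "openin (prod_topology X Y) W" "(a, b) \<in> W" "\<forall>z\<in>W. P z"
      using assms by (auto simp: eventually_nhdsin)
    then obtain U V where "openin X U" "openin Y V" "a \<in> U" "b \<in> V" "U \<times> V \<subseteq> W"
      by (metis openin_prod_topology_alt)
    then show ?R
      unfolding eventually_prod_filter
      using W(3) by (intro exI[of _ "\<lambda>x. x \<in> U"] exI[of _ "\<lambda>y. y \<in> V"])
        (auto simp: eventually_nhdsin)
  next
    assume ?R
    then obtain Q R where QR: "eventually Q (nhdsin X a)" "eventually R (nhdsin Y b)"
      "\<And>x y. Q x \<Longrightarrow> R y \<Longrightarrow> P (x, y)"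
      unfolding eventually_prod_filter by blast
    then obtain U V where "openin X U" "a \<in> U" "\<forall>x\<in>U. Q x" "openin Y V" "b \<in> V" "\<forall>y\<in>V. R y"
      using assms by (auto simp: eventually_nhdsin)
    then show ?L
      unfolding eventually_nhdsin using QR(3)
      by (intro disjI2 exI[of _ "U \<times> V"]) (auto simp: openin_prod_Times_iff)
  qed
qed

lemma nhdsin_euclidean: "nhdsin euclidean = nhds"
  by (intro ext filter_eqI) (auto simp: eventually_nhdsin eventually_nhds)

text \<open>If \<open>P\<close> holds eventually along \<open>M\<close> but not along \<open>N\<close>, every member of \<open>N\<close> contains a point
  outside \<open>P\<close>. The net of these points, indexed by the members, converges along \<open>N\<close> only.\<close>

lemma filter_le_if_nets_converge:
  fixes M N :: "'a filter"
  assumes nets: "\<And>(A :: 'a set set) le (x :: 'a set \<Rightarrow> 'a). directed_set A le \<Longrightarrow>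
    filterlim x N (tails A le) \<Longrightarrow> filterlim x M (tails A le)"
  shows "N \<le> M"
proof (rule filter_leI, rule ccontr)
  fix P assume P: "eventually P M" "\<not> eventually P N"
  define A where "A = {X. eventually (\<lambda>x. x \<in> X) N}"
  define le where "le X Y \<longleftrightarrow> Y \<subseteq> X" for X Y :: "'a set"
  have dir: "directed_set A le"
    unfolding directed_set_def
  proof (intro conjI ballI)
    show "A \<noteq> {}"
      by (auto simp: A_def intro!: exI[of _ UNIV])
    show "reflp_on A le" "transp_on A le"
      by (auto simp: le_def reflp_on_def transp_on_def)
    fix X Y assume "X \<in> A" "Y \<in> A"
    then show "\<exists>Z\<in>A. le X Z \<and> le Y Z"
      by (intro bexI[of _ "X \<inter> Y"]) (auto simp: A_def le_def eventually_conj)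
  qed
  have "\<exists>x. x \<in> X \<and> \<not> P x" if "X \<in> A" for X
  proof (rule ccontr)
    assume "\<not> (\<exists>x. x \<in> X \<and> \<not> P x)"
    with that have "eventually P N"
      unfolding A_def mem_Collect_eq by (elim eventually_mono) blast
    with P(2) show False ..
  qed
  then obtain x where x: "\<And>X. X \<in> A \<Longrightarrow> x X \<in> X \<and> \<not> P (x X)"
    by metis
  have "filterlim x N (tails A le)"
    unfolding filterlim_iff eventually_tails[OF dir]
  proof (intro allI impI)
    fix Q assume "eventually Q N"
    then show "\<exists>X\<in>A. \<forall>Y\<in>A. le X Y \<longrightarrow> Q (x Y)"
      using x by (intro bexI[of _ "{z. Q z}"]) (auto simp: A_def le_def)
  qed
  then have "eventually (\<lambda>X. P (x X)) (tails A le)"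
    using nets[OF dir] P(1) by (auto simp: filterlim_iff)
  then obtain X where "X \<in> A" "\<forall>Y\<in>A. le X Y \<longrightarrow> P (x Y)"
    unfolding eventually_tails[OF dir] by blast
  then show False
    using x by (auto simp: le_def)
qed

section \<open>Additive topologies\<close>

text \<open>The axioms for the neighbourhoods of 0 in a commutative topological group: each member
  contains 0, and it contains V + V and -V for some member V.\<close>

definition group_filter :: "'a::ab_group_add filter \<Rightarrow> bool" where
  "group_filter N \<longleftrightarrow> (\<forall>P. eventually P N \<longrightarrow> P 0) \<and>
    filterlim (\<lambda>(x, y). x + y) N (N \<times>\<^sub>F N) \<and> filterlim uminus N N"

definition group_filter_topology :: "'a::ab_group_add filter \<Rightarrow> 'a topology" where
  "group_filter_topology N = topology (\<lambda>U. \<forall>a\<in>U. eventually (\<lambda>x. a + x \<in> U) N)"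

lemma openin_group_filter_topology:
  "openin (group_filter_topology N) U \<longleftrightarrow> (\<forall>a\<in>U. eventually (\<lambda>x. a + x \<in> U) N)"
proof -
  have "istopology (\<lambda>U. \<forall>a\<in>U. eventually (\<lambda>x. a + x \<in> U) N)"
    unfolding istopology_def
  proof (intro conjI allI impI)
    fix S T assume "\<forall>a\<in>S. eventually (\<lambda>x. a + x \<in> S) N" "\<forall>a\<in>T. eventually (\<lambda>x. a + x \<in> T) N"
    then show "\<forall>a\<in>S \<inter> T. eventually (\<lambda>x. a + x \<in> S \<inter> T) N"
      by (auto intro: eventually_conj)
  next
    fix \<K> assume R: "\<forall>K\<in>\<K>. \<forall>a\<in>K. eventually (\<lambda>x. a + x \<in> K) N"
    show "\<forall>a\<in>\<Union>\<K>. eventually (\<lambda>x. a + x \<in> \<Union>\<K>) N"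
    proof
      fix a assume "a \<in> \<Union>\<K>"
      then obtain K where K: "K \<in> \<K>" "a \<in> K"
        by blast
      with R have "eventually (\<lambda>x. a + x \<in> K) N"
        by blast
      then show "eventually (\<lambda>x. a + x \<in> \<Union>\<K>) N"
        by (rule eventually_mono) (use K in blast)
    qed
  qed
  then show ?thesis
    by (simp add: group_filter_topology_def)
qed

lemma topspace_group_filter_topology [simp]: "topspace (group_filter_topology N) = UNIV"
proof -
  have "openin (group_filter_topology N) UNIV"
    by (simp add: openin_group_filter_topology)
  then show ?thesis
    using openin_subset by blast
qed

text \<open>The point is that there are enough open sets. Continuity of addition shows that the
  points near which \<open>P\<close> holds form an open set, and this set lies inside
  \<open>P\<close>.\<close>

lemma nhdsin_group_filter_topology:
  assumes "group_filter N"
  shows "nhdsin (group_filter_topology N) a = filtermap ((+) a) N"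
proof (rule filter_eqI)
  fix P
  have "eventually P (nhdsin (group_filter_topology N) a)" if P: "eventually (\<lambda>x. P (a + x)) N"
  proof -
    define U where "U = {b. eventually (\<lambda>x. P (b + x)) N}"
    have "eventually (\<lambda>x. b + x \<in> U) N" if "b \<in> U" for b
    proof -
      \<comment> \<open>A small vector is split as x + y. For each x with \<open>Q x\<close>, all
        small y keep \<open>P\<close> true at b + x + y, so b + x is again in
        \<open>U\<close>.\<close>
      have "eventually (\<lambda>(x, y). P (b + (x + y))) (N \<times>\<^sub>F N)"
        using assms that unfolding group_filter_def filterlim_iff U_def
        by (auto simp: case_prod_unfold)
      then obtain Q R where QR: "eventually Q N" "eventually R N"
        "\<And>x y. Q x \<Longrightarrow> R y \<Longrightarrow> P (b + (x + y))"
        by (auto simp: eventually_prod_filter)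
      have "eventually (\<lambda>y. P (b + x + y)) N" if "Q x" for x
        using QR(2) by (rule eventually_mono) (use QR(3) that in \<open>auto simp: add.assoc\<close>)
      then show ?thesis
        unfolding U_def mem_Collect_eq by (rule eventually_mono[OF QR(1)])
    qed
    then have "openin (group_filter_topology N) U"
      by (simp add: openin_group_filter_topology)
    \<comment> \<open>Every member of \<open>N\<close> contains 0, so \<open>P\<close> holds on all
      of \<open>U\<close>.\<close>
    moreover have "P (b + 0)" if "b \<in> U" for b
      using assms that by (auto simp only: group_filter_def U_def mem_Collect_eq)
    ultimately show ?thesis
      using P by (auto simp: eventually_nhdsin U_def)
  qed
  moreover have "eventually (\<lambda>x. P (a + x)) N"
    if P: "eventually P (nhdsin (group_filter_topology N) a)"
  proof -
    obtain U where U: "openin (group_filter_topology N) U" "a \<in> U" "\<forall>x\<in>U. P x"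
      using P by (auto simp: eventually_nhdsin)
    then have "eventually (\<lambda>x. a + x \<in> U) N"
      by (simp add: openin_group_filter_topology)
    then show ?thesis
      by (rule eventually_mono) (use U(3) in blast)
  qed
  ultimately show "eventually P (nhdsin (group_filter_topology N) a) \<longleftrightarrow>
      eventually P (filtermap ((+) a) N)"
    by (auto simp: eventually_filtermap)
qed

lemma additive_topology_on_group_filter_topology:
  fixes N :: "'a::real_vector filter"
  assumes "group_filter N"
  shows "additive_topology_on UNIV (group_filter_topology N)"
proof -
  \<comment> \<open>The identity (a + x) + (b + y) = (a + b) + (x + y) moves the limit to 0.\<close>
  have sum: "filterlim (\<lambda>(x, y). x + y) (filtermap ((+) (a + b)) N)
      (filtermap ((+) a) N \<times>\<^sub>F filtermap ((+) b) N)" for a b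
  proof -
    have "filterlim (\<lambda>(x, y). x + y) N (N \<times>\<^sub>F N)"
      using assms by (simp add: group_filter_def)
    then have "filterlim (\<lambda>z. (a + b) + (fst z + snd z)) (filtermap ((+) (a + b)) N) (N \<times>\<^sub>F N)"
      by (auto simp: filterlim_iff eventually_filtermap case_prod_unfold)
    then show ?thesis
      by (simp add: prod_filtermap1 prod_filtermap2 filterlim_filtermap case_prod_unfold
          algebra_simps)
  qed
  have neg: "filterlim uminus (filtermap ((+) (- a)) N) (filtermap ((+) a) N)" for a
  proof -
    have "filterlim uminus N N"
      using assms by (simp add: group_filter_def)
    moreover have "filterlim ((+) (- a)) (filtermap ((+) (- a)) N) N"
      by (simp add: filterlim_def)
    ultimately have "filterlim (\<lambda>x. - a + - x) (filtermap ((+) (- a)) N) N"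
      by (rule filterlim_compose[rotated])
    then show ?thesis
      by (simp add: filterlim_filtermap)
  qed
  show ?thesis
    unfolding additive_topology_on_def continuous_map_iff_filterlim
    using sum neg
    by (auto simp: nhdsin_prod_topology nhdsin_group_filter_topology[OF assms])
qed

section \<open>Limits and separation in a given additive topology\<close>

context
  fixes G :: "'a::real_vector set" and \<tau> :: "'a topology"
  assumes G: "subspace G" and \<tau>: "additive_topology_on G \<tau>"
begin

lemma additive_topology_on_topspace: "topspace \<tau> = G"
  using \<tau> by (simp add: additive_topology_on_def)

lemma eventually_nhdsin_mem: "eventually (\<lambda>x. x \<in> G) (nhdsin \<tau> a)"
  unfolding eventually_nhdsin additive_topology_on_topspace[symmetric]
  by (meson openin_topspace)

lemma filterlim_add_nhdsin:
  assumes "filterlim f (nhdsin \<tau> a) H" "filterlim g (nhdsin \<tau> b) H" "a \<in> G" "b \<in> G"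
  shows "filterlim (\<lambda>z. f z + g z) (nhdsin \<tau> (a + b)) H"
proof -
  have "continuous_map (prod_topology \<tau> \<tau>) \<tau> (\<lambda>(x, y). x + y)"
    using \<tau> by (simp add: additive_topology_on_def)
  then have "filterlim (\<lambda>(x, y). x + y) (nhdsin \<tau> (a + b)) (nhdsin \<tau> a \<times>\<^sub>F nhdsin \<tau> b)"
    using assms(3,4)
    by (auto simp: continuous_map_iff_filterlim additive_topology_on_topspace nhdsin_prod_topology)
  from filterlim_compose[OF this filterlim_Pair[OF assms(1,2)]] show ?thesis
    by simp
qed

lemma filterlim_minus_nhdsin:
  assumes "filterlim f (nhdsin \<tau> a) H" "a \<in> G"
  shows "filterlim (\<lambda>z. - f z) (nhdsin \<tau> (- a)) H"
proof -
  have "continuous_map \<tau> \<tau> uminus"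
    using \<tau> by (simp add: additive_topology_on_def)
  then have "filterlim uminus (nhdsin \<tau> (- a)) (nhdsin \<tau> a)"
    using assms(2) by (auto simp: continuous_map_iff_filterlim additive_topology_on_topspace)
  from filterlim_compose[OF this assms(1)] show ?thesis .
qed

lemma filterlim_const_nhdsin: "filterlim (\<lambda>_. a) (nhdsin \<tau> a) H" if "a \<in> G"
  using that additive_topology_on_topspace by (auto simp: filterlim_iff eventually_nhdsin)

text \<open>Adding the constant \<open>a\<close> or \<open>- a\<close> preserves limits, so every
  limit can be tested at 0.\<close>

lemma filterlim_nhdsin_iff_diff:
  assumes "a \<in> G"
  shows "filterlim f (nhdsin \<tau> a) H \<longleftrightarrow> filterlim (\<lambda>z. f z - a) (nhdsin \<tau> 0) H"
proof
  assume "filterlim f (nhdsin \<tau> a) H"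
  from filterlim_add_nhdsin[OF this filterlim_const_nhdsin[of "- a"]]
  show "filterlim (\<lambda>z. f z - a) (nhdsin \<tau> 0) H"
    using assms G by (simp add: subspace_neg)
next
  assume "filterlim (\<lambda>z. f z - a) (nhdsin \<tau> 0) H"
  from filterlim_add_nhdsin[OF this filterlim_const_nhdsin[of a]]
  show "filterlim f (nhdsin \<tau> a) H"
    using assms G by (simp add: subspace_0)
qed

text \<open>Real multiples need not be continuous in an additive topology, but natural ones are
  repeated sums. Solidity later bounds real multiples by these.\<close>

lemma filterlim_scaleR_nat_nhdsin:
  assumes "filterlim f (nhdsin \<tau> 0) H"
  shows "filterlim (\<lambda>z. real n *\<^sub>R f z) (nhdsin \<tau> 0) H"
proof (induction n)
  case 0
  then show ?case
    using filterlim_const_nhdsin[of 0] G by (simp add: subspace_0)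
next
  case (Suc n)
  from filterlim_add_nhdsin[OF assms this] show ?case
    using G by (simp add: subspace_0 scaleR_add_left)
qed

text \<open>Translation carries the neighbourhoods of 0 to those of \<open>a\<close>, so the filter
  at 0 determines the topology. This gives uniqueness of the unbounded topology.\<close>

lemma openin_additive_topology_iff:
  "openin \<tau> U \<longleftrightarrow> U \<subseteq> G \<and> (\<forall>a\<in>U. eventually (\<lambda>x. a + x \<in> U) (nhdsin \<tau> 0))"
proof -
  have "eventually (\<lambda>x. x \<in> U) (nhdsin \<tau> a) \<longleftrightarrow> eventually (\<lambda>x. a + x \<in> U) (nhdsin \<tau> 0)"
    if "a \<in> G" for a
  proof -
    have "filterlim (\<lambda>x. x - a) (nhdsin \<tau> 0) (nhdsin \<tau> a)"
      using that filterlim_nhdsin_iff_diff[of a "\<lambda>x. x" "nhdsin \<tau> a"]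
      by (simp add: filterlim_ident)
    moreover have "filterlim (\<lambda>x. a + x) (nhdsin \<tau> a) (nhdsin \<tau> 0)"
      using that by (simp add: filterlim_nhdsin_iff_diff filterlim_ident)
    ultimately show ?thesis
      using eventually_compose_filterlim[of "\<lambda>x. x \<in> U" "nhdsin \<tau> a" "\<lambda>x. a + x" "nhdsin \<tau> 0"]
        eventually_compose_filterlim[of "\<lambda>x. a + x \<in> U" "nhdsin \<tau> 0" "\<lambda>x. x - a" "nhdsin \<tau> a"]
      by auto
  qed
  then show ?thesis
    unfolding openin_iff_eventually_nhdsin additive_topology_on_topspace
    by (intro conj_cong ball_cong refl) auto
qed

text \<open>A constant family over \<open>unit\<close> tends to 0 exactly when its value lies in
  every neighbourhood of 0. In a Hausdorff space it has only one limit. Conversely, if only 0 passes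
  the test, then {0} is closed, and so is the diagonal, its preimage under subtraction.\<close>

lemma Hausdorff_additive_topology_iff:
  "Hausdorff_space \<tau> \<longleftrightarrow> (\<forall>x\<in>G. filterlim (\<lambda>_::unit. x) (nhdsin \<tau> 0) top \<longrightarrow> x = 0)"
proof
  assume "Hausdorff_space \<tau>"
  show "\<forall>x\<in>G. filterlim (\<lambda>_::unit. x) (nhdsin \<tau> 0) top \<longrightarrow> x = 0"
  proof (intro ballI impI)
    fix x assume "x \<in> G" "filterlim (\<lambda>_::unit. x) (nhdsin \<tau> 0) top"
    then have "limitin \<tau> (\<lambda>_::unit. x) 0 top" "limitin \<tau> (\<lambda>_::unit. x) x top"
      using G filterlim_const_nhdsin
      by (auto simp: limitin_iff_filterlim_nhdsin additive_topology_on_topspace subspace_0)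
    with \<open>Hausdorff_space \<tau>\<close> show "x = 0"
      by (rule limitin_Hausdorff_unique[rotated 3, symmetric]) (auto simp: filter_eq_iff)
  qed
next
  assume R: "\<forall>x\<in>G. filterlim (\<lambda>_::unit. x) (nhdsin \<tau> 0) top \<longrightarrow> x = 0"
  \<comment> \<open>The complement of {0} is open: a + x = 0 only for x = -a, and some neighbourhood
    of 0 misses -a.\<close>
  have "eventually (\<lambda>x. a + x \<in> G - {0}) (nhdsin \<tau> 0)" if "a \<in> G" "a \<noteq> 0" for a
  proof -
    have "- a \<in> G" "- a \<noteq> 0"
      using that G by (auto simp: subspace_neg)
    then have "\<not> filterlim (\<lambda>_::unit. - a) (nhdsin \<tau> 0) top"
      using R by blast
    then obtain P where P: "eventually P (nhdsin \<tau> 0)" "\<not> P (- a)"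
      by (auto simp: filterlim_iff)
    from eventually_nhdsin_mem[of 0] P(1) show ?thesis
      by (rule eventually_elim2)
        (use P(2) that G in \<open>auto simp: subspace_add add_eq_0_iff\<close>)
  qed
  then have "closedin \<tau> {0}"
    using G by (auto simp: closedin_def openin_additive_topology_iff additive_topology_on_topspace
        subspace_0)
  moreover have "continuous_map (prod_topology \<tau> \<tau>) \<tau> (\<lambda>(x, y). x - y)"
    unfolding continuous_map_iff_filterlim
  proof clarsimp
    fix a b assume ab: "a \<in> topspace \<tau>" "b \<in> topspace \<tau>"
    then have "a \<in> G" "b \<in> G" "- b \<in> G"
      using G by (auto simp: additive_topology_on_topspace subspace_neg)
    moreover from this have
      "filterlim (\<lambda>z. fst z + - snd z) (nhdsin \<tau> (a + - b)) (nhdsin \<tau> a \<times>\<^sub>F nhdsin \<tau> b)"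
      by (intro filterlim_add_nhdsin filterlim_minus_nhdsin)
        (auto simp: filterlim_def filtermap_fst_prod_filter filtermap_snd_prod_filter)
    ultimately show "a - b \<in> topspace \<tau> \<and>
        filterlim (\<lambda>(x, y). x - y) (nhdsin \<tau> (a - b)) (nhdsin (prod_topology \<tau> \<tau>) (a, b))"
      using G ab by (simp add: nhdsin_prod_topology case_prod_unfold additive_topology_on_topspace
          subspace_diff)
  qed
  ultimately have "closedin (prod_topology \<tau> \<tau>)
      {z \<in> topspace (prod_topology \<tau> \<tau>). (case z of (x, y) \<Rightarrow> x - y) \<in> {0}}"
    by (rule closedin_continuous_map_preimage[rotated])
  also have "{z \<in> topspace (prod_topology \<tau> \<tau>). (case z of (x, y) \<Rightarrow> x - y) \<in> {0}} =
      (\<lambda>x. (x, x)) ` topspace \<tau>"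
    by auto
  finally show "Hausdorff_space \<tau>"
    by (simp add: Hausdorff_space_closedin_diagonal)
qed

end

section \<open>Ideals and locally solid topologies\<close>

lemma abs_scaleR:
  fixes x :: "'a::archimedean_vector_lattice"
  shows "\<bar>c *\<^sub>R x\<bar> = \<bar>c\<bar> *\<^sub>R \<bar>x\<bar>"
proof -
  have nonneg: "\<bar>c *\<^sub>R x\<bar> \<le> c *\<^sub>R \<bar>x\<bar>" if "0 \<le> c" for c and x :: 'a
    using that by (intro abs_leI)
      (auto simp: scaleR_left_mono abs_ge_self abs_ge_minus_self simp flip: scaleR_minus_right)
  have le: "\<bar>c *\<^sub>R x\<bar> \<le> \<bar>c\<bar> *\<^sub>R \<bar>x\<bar>" for c and x :: 'a
    using nonneg[of c x] nonneg[of "- c" x] by (cases "0 \<le> c") auto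
  show ?thesis
  proof (cases "c = 0")
    case False
    \<comment> \<open>The upper bound \<open>le\<close>, applied to the scalar
      \<open>inverse c\<close> and the vector \<open>c *\<^sub>R x\<close>, yields the reverse
      inequality.\<close>
    have "\<bar>c\<bar> *\<^sub>R \<bar>inverse c *\<^sub>R (c *\<^sub>R x)\<bar> \<le> \<bar>c\<bar> *\<^sub>R (\<bar>inverse c\<bar> *\<^sub>R \<bar>c *\<^sub>R x\<bar>)"
      by (intro scaleR_left_mono le) auto
    with False have "\<bar>c\<bar> *\<^sub>R \<bar>x\<bar> \<le> \<bar>c *\<^sub>R x\<bar>"
      by simp
    with le show ?thesis
      by (rule antisym)
  qed simp
qed

lemma abs_scaleR_mono:
  fixes x :: "'a::archimedean_vector_lattice"
  assumes "\<bar>c\<bar> \<le> \<bar>d\<bar>"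
  shows "\<bar>c *\<^sub>R x\<bar> \<le> \<bar>d *\<^sub>R x\<bar>"
  using assms by (simp add: abs_scaleR scaleR_right_mono)

text \<open>After distributing, the right side is the infimum of four sums of two absolute values.
  One is \<bar>x\<bar> + \<bar>y\<bar>, and each of the others contains \<bar>s\<bar>, so all
  dominate the left side.\<close>

lemma inf_abs_add_le:
  fixes x y s :: "'a::archimedean_vector_lattice"
  shows "inf \<bar>x + y\<bar> \<bar>s\<bar> \<le> (inf \<bar>x\<bar> \<bar>s\<bar>) + (inf \<bar>y\<bar> \<bar>s\<bar>)"
proof -
  have "inf \<bar>x + y\<bar> \<bar>s\<bar> \<le> inf (\<bar>x\<bar> + \<bar>y\<bar>) (\<bar>s\<bar>)"
    by (rule inf_mono) (auto intro: abs_triangle_ineq)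
  also have "\<dots> \<le> inf \<bar>x\<bar> \<bar>s\<bar> + inf \<bar>y\<bar> \<bar>s\<bar>"
    by (auto simp: add_inf_distrib_left add_inf_distrib_right
        intro: le_infI1 le_infI2 add_increasing add_increasing2)
  finally show ?thesis .
qed

lemma abs_inf_abs [simp]:
  fixes x s :: "'a::archimedean_vector_lattice"
  shows "\<bar>inf \<bar>x\<bar> \<bar>s\<bar>\<bar> = inf \<bar>x\<bar> \<bar>s\<bar>"
  by (rule abs_of_nonneg) simp

lemma abs_add_inf_abs [simp]:
  fixes x y s t :: "'a::archimedean_vector_lattice"
  shows "\<bar>inf \<bar>x\<bar> \<bar>s\<bar> + inf \<bar>y\<bar> \<bar>t\<bar>\<bar> = inf \<bar>x\<bar> \<bar>s\<bar> + inf \<bar>y\<bar> \<bar>t\<bar>"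
  by (rule abs_of_nonneg) simp

lemma order_ideal_subspace: "order_ideal I \<Longrightarrow> subspace I"
  by (simp add: order_ideal_def)

lemma order_ideal_solid: "order_ideal I \<Longrightarrow> x \<in> I \<Longrightarrow> \<bar>y\<bar> \<le> \<bar>x\<bar> \<Longrightarrow> y \<in> I"
  by (auto simp: order_ideal_def solid_in_def)

lemma inf_abs_in_order_ideal: "order_ideal I \<Longrightarrow> s \<in> I \<Longrightarrow> inf \<bar>x\<bar> \<bar>s\<bar> \<in> I"
  by (erule order_ideal_solid) auto

lemma order_idealI:
  assumes zero: "0 \<in> I"
    and add: "\<And>x y. x \<in> I \<Longrightarrow> y \<in> I \<Longrightarrow> x + y \<in> I"
    and solid: "\<And>x y. x \<in> I \<Longrightarrow> \<bar>y\<bar> \<le> \<bar>x\<bar> \<Longrightarrow> y \<in> I"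
  shows "order_ideal I"
proof -
  have nat: "real n *\<^sub>R x \<in> I" if "x \<in> I" for n x
    by (induction n) (use that in \<open>auto simp: zero add scaleR_add_left\<close>)
  have "c *\<^sub>R x \<in> I" if "x \<in> I" for c x
  proof -
    \<comment> \<open>A natural multiple is a repeated sum, and by solidity it absorbs the real
      multiple \<open>c *\<^sub>R x\<close>.\<close>
    obtain n where "\<bar>c\<bar> \<le> real n"
      using real_arch_simple by blast
    then show ?thesis
      by (intro solid[OF nat[OF that, of n]] abs_scaleR_mono) simp
  qed
  then show ?thesis
    unfolding order_ideal_def subspace_def solid_in_def
    using zero add solid by blast
qed

lemma order_ideal_generated_ideal: "order_ideal (generated_ideal S)"
proof (rule hull_in)
  fix T assume T: "\<forall>I\<in>T. order_ideal I"
  then have "subspace (\<Inter>T)"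
    by (intro subspace_Inter) (auto simp: order_ideal_subspace)
  with T show "order_ideal (\<Inter>T)"
    unfolding order_ideal_def solid_in_def by blast
qed

text \<open>The squeeze principle: once \<open>f\<close> is in a solid neighbourhood of 0, so is
  every element of \<open>G\<close> that it dominates.\<close>

lemma filterlim_nhdsin_dominated:
  assumes \<tau>: "locally_solid_additive_topology_on G \<tau>"
    and f: "filterlim f (nhdsin \<tau> 0) H"
    and g: "eventually (\<lambda>z. g z \<in> G \<and> \<bar>g z\<bar> \<le> \<bar>f z\<bar>) H"
  shows "filterlim g (nhdsin \<tau> 0) H"
proof (cases "0 \<in> topspace \<tau>")
  case True
  show ?thesis
    unfolding filterlim_iff
  proof (intro allI impI)
    fix P assume "eventually P (nhdsin \<tau> 0)"
    then obtain U where "openin \<tau> U" "0 \<in> U" "\<forall>x\<in>U. P x"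
      using True by (auto simp: eventually_nhdsin)
    moreover from this obtain V W where "solid_in G V" "V \<subseteq> U" "openin \<tau> W" "0 \<in> W" "W \<subseteq> V"
      using \<tau> unfolding locally_solid_additive_topology_on_def by metis
    moreover from this have "eventually (\<lambda>z. f z \<in> W) H"
      using f by (auto simp: filterlim_iff eventually_nhdsin)
    from g this have "eventually (\<lambda>z. (g z \<in> G \<and> \<bar>g z\<bar> \<le> \<bar>f z\<bar>) \<and> f z \<in> W) H"
      by (rule eventually_conj)
    ultimately show "eventually (\<lambda>z. P (g z)) H"
      by (elim eventually_mono) (unfold solid_in_def, blast)
  qed
next
  case False
  \<comment> \<open>Here \<open>nhdsin \<tau> 0\<close> is \<open>bot\<close>, and only along
    \<open>bot\<close> can anything converge to it.\<close>
  then have "H = bot"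
    using f by (simp add: filterlim_def filtermap_bot_iff bot_unique)
  then show ?thesis
    by (simp add: filterlim_iff)
qed

text \<open>The witness \<open>g\<close> moves each point outside the solid kernel \<open>V\<close> of \<open>U\<close> to a smaller one
  outside \<open>U\<close>. It still tends to \<open>0\<close>, so \<open>V\<close> is a neighbourhood of \<open>0\<close>.\<close>

lemma locally_solid_additive_topology_onI:
  assumes G: "0 \<in> G" and \<tau>: "additive_topology_on G \<tau>"
    and dominated: "\<And>g. (\<And>x. x \<in> G \<Longrightarrow> g x \<in> G \<and> \<bar>g x\<bar> \<le> \<bar>x\<bar>) \<Longrightarrow>
      filterlim g (nhdsin \<tau> 0) (nhdsin \<tau> 0)"
  shows "locally_solid_additive_topology_on G \<tau>"
  unfolding locally_solid_additive_topology_on_def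
proof (intro conjI allI impI \<tau>)
  fix U assume U: "openin \<tau> U \<and> 0 \<in> U"
  have top: "topspace \<tau> = G"
    using \<tau> by (simp add: additive_topology_on_def)
  define V where "V = {x\<in>G. \<forall>y\<in>G. \<bar>y\<bar> \<le> \<bar>x\<bar> \<longrightarrow> y \<in> U}"
  have "\<exists>y. x \<in> G \<longrightarrow> y \<in> G \<and> \<bar>y\<bar> \<le> \<bar>x\<bar> \<and> (x \<in> V \<or> y \<notin> U)" for x
    by (auto simp: V_def)
  then obtain g where g: "\<And>x. x \<in> G \<Longrightarrow> g x \<in> G \<and> \<bar>g x\<bar> \<le> \<bar>x\<bar> \<and> (x \<in> V \<or> g x \<notin> U)"
    by metis
  have "eventually (\<lambda>x. g x \<in> U) (nhdsin \<tau> 0)"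
    using dominated[of g] g U by (auto simp: filterlim_iff eventually_nhdsin)
  then obtain W where "openin \<tau> W" "0 \<in> W" "\<forall>x\<in>W. g x \<in> U"
    using G by (auto simp: eventually_nhdsin top)
  moreover from this have "W \<subseteq> V"
    using g openin_subset top by blast
  moreover have "solid_in G V" "V \<subseteq> U"
    by (auto simp: solid_in_def V_def intro: order_trans)
  ultimately show "\<exists>V. solid_in G V \<and> V \<subseteq> U \<and> (\<exists>W. openin \<tau> W \<and> 0 \<in> W \<and> W \<subseteq> V)"
    by blast
qed

section \<open>The unbounded topology\<close>

definition unbounded_filter ::
    "'a topology \<Rightarrow> 'a set \<Rightarrow> 'a::archimedean_vector_lattice filter" where
  "unbounded_filter \<tau>F S = (INF s\<in>S. filtercomap (\<lambda>x. inf \<bar>x\<bar> \<bar>s\<bar>) (nhdsin \<tau>F 0))"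

text \<open>The universal property of an infimum of inverse images, and the only access to
  \<open>unbounded_filter\<close> from here on. As \<open>H\<close> is arbitrary, it covers nets,
  \<epsilon> \<rightarrow> 0 and product filters alike.\<close>

lemma filterlim_unbounded_filter:
  "filterlim f (unbounded_filter \<tau>F S) H \<longleftrightarrow>
    (\<forall>s\<in>S. filterlim (\<lambda>z. inf \<bar>f z\<bar> \<bar>s\<bar>) (nhdsin \<tau>F 0) H)"
  by (simp add: unbounded_filter_def filterlim_INF filterlim_filtercomap_iff o_def)

text \<open>Nets indexed by sets of subsets of the space suffice to compare two filters, so the net
  condition amounts to an equality of filters. Later arguments then need no restriction on the index
  type.\<close>

lemma is_unbounded_topology_iff:
  assumes F: "0 \<in> topspace \<tau>F"
  shows "is_unbounded_topology \<tau>F S \<tau> \<longleftrightarrow>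
    additive_topology_on UNIV \<tau> \<and> nhdsin \<tau> 0 = unbounded_filter \<tau>F S"
proof -
  have lim: "(limitin \<tau> x 0 (tails A le) \<longleftrightarrow>
         (\<forall>s\<in>S. limitin \<tau>F (\<lambda>\<alpha>. inf \<bar>x \<alpha>\<bar> \<bar>s\<bar>) 0 (tails A le))) \<longleftrightarrow>
      (filterlim x (nhdsin \<tau> 0) (tails A le) \<longleftrightarrow>
        filterlim x (unbounded_filter \<tau>F S) (tails A le))"
    if "additive_topology_on UNIV \<tau>" for A :: "'a set set" and le and x :: "'a set \<Rightarrow> 'a"
    using that F
    by (simp add: filterlim_unbounded_filter limitin_iff_filterlim_nhdsin additive_topology_on_def)
  show ?thesis
  proof
    assume u: "is_unbounded_topology \<tau>F S \<tau>"
    then have \<tau>: "additive_topology_on UNIV \<tau>"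
      by (simp add: is_unbounded_topology_def)
    have "filterlim x (nhdsin \<tau> 0) (tails A le) \<longleftrightarrow>
        filterlim x (unbounded_filter \<tau>F S) (tails A le)"
      if "directed_set A le" for A :: "'a set set" and le and x :: "'a set \<Rightarrow> 'a"
      using u that unfolding is_unbounded_topology_def lim[OF \<tau>, symmetric] by blast
    then have "nhdsin \<tau> 0 = unbounded_filter \<tau>F S"
      by (intro antisym filter_le_if_nets_converge) auto
    with \<tau> show "additive_topology_on UNIV \<tau> \<and> nhdsin \<tau> 0 = unbounded_filter \<tau>F S"
      by blast
  next
    assume R: "additive_topology_on UNIV \<tau> \<and> nhdsin \<tau> 0 = unbounded_filter \<tau>F S"
    show "is_unbounded_topology \<tau>F S \<tau>"
      unfolding is_unbounded_topology_def
    proof (intro conjI allI impI)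
      show \<tau>: "additive_topology_on UNIV \<tau>"
        using R by blast
      fix A :: "'a set set" and le and x :: "'a set \<Rightarrow> 'a"
      show "limitin \<tau> x 0 (tails A le) \<longleftrightarrow>
          (\<forall>s\<in>S. limitin \<tau>F (\<lambda>\<alpha>. inf \<bar>x \<alpha>\<bar> \<bar>s\<bar>) 0 (tails A le))"
        unfolding lim[OF \<tau>] using R by simp
    qed
  qed
qed

section \<open>Existence, uniqueness and passage to the generated ideal\<close>

context
  fixes F S :: "'a::archimedean_vector_lattice set" and \<tau>F :: "'a topology"
  assumes F: "order_ideal F"
    and \<tau>F: "locally_solid_additive_topology_on F \<tau>F"
    and S: "S \<subseteq> F"
begin

lemma additive_topology_on_ideal: "additive_topology_on F \<tau>F"
  using \<tau>F by (simp add: locally_solid_additive_topology_on_def)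

lemmas subspace_ideal = order_ideal_subspace[OF F]

lemma zero_in_topspace_ideal: "0 \<in> topspace \<tau>F"
  using additive_topology_on_ideal subspace_0[OF subspace_ideal]
  by (simp add: additive_topology_on_def)

text \<open>Serves two sums: of two vectors truncated by one element of \<open>S\<close>, and of two
  truncating elements for one family \<open>f\<close>.\<close>

lemma filterlim_inf_abs_add:
  assumes "filterlim (\<lambda>z. inf \<bar>f z\<bar> \<bar>s z\<bar>) (nhdsin \<tau>F 0) H"
    and "filterlim (\<lambda>z. inf \<bar>g z\<bar> \<bar>t z\<bar>) (nhdsin \<tau>F 0) H"
    and "\<And>z. h z \<in> F" "\<And>z. \<bar>h z\<bar> \<le> inf \<bar>f z\<bar> \<bar>s z\<bar> + inf \<bar>g z\<bar> \<bar>t z\<bar>"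
  shows "filterlim h (nhdsin \<tau>F 0) H"
proof (rule filterlim_nhdsin_dominated[OF \<tau>F])
  show "filterlim (\<lambda>z. inf \<bar>f z\<bar> \<bar>s z\<bar> + inf \<bar>g z\<bar> \<bar>t z\<bar>) (nhdsin \<tau>F 0) H"
    using filterlim_add_nhdsin[OF subspace_ideal additive_topology_on_ideal assms(1,2)]
      subspace_0[OF subspace_ideal] by simp
  show "eventually (\<lambda>z. h z \<in> F \<and> \<bar>h z\<bar> \<le> \<bar>inf \<bar>f z\<bar> \<bar>s z\<bar> + inf \<bar>g z\<bar> \<bar>t z\<bar>\<bar>) H"
    using assms(3,4) by simp
qed

lemma filterlim_zero_ideal: "filterlim (\<lambda>_. 0) (nhdsin \<tau>F 0) H"
  by (rule filterlim_const_nhdsin[OF subspace_ideal additive_topology_on_ideal])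
    (rule subspace_0[OF subspace_ideal])

lemma limitin_iff_unbounded_filter:
  "(\<forall>s\<in>T. limitin \<tau>F (\<lambda>z. inf \<bar>f z\<bar> \<bar>s\<bar>) 0 H) \<longleftrightarrow> filterlim f (unbounded_filter \<tau>F T) H"
  using zero_in_topspace_ideal
  by (simp add: filterlim_unbounded_filter limitin_iff_filterlim_nhdsin)

lemma group_filter_unbounded_filter: "group_filter (unbounded_filter \<tau>F S)"
  unfolding group_filter_def
proof (intro conjI)
  let ?N = "unbounded_filter \<tau>F S"
  \<comment> \<open>That the constant 0 tends to \<open>?N\<close> says that every member of
    \<open>?N\<close> contains 0.\<close>
  have "filterlim (\<lambda>_::unit. 0) ?N top"
    by (simp add: filterlim_unbounded_filter filterlim_zero_ideal inf_absorb1)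
  then show "\<forall>P. eventually P ?N \<longrightarrow> P 0"
    by (simp add: filterlim_iff)
  have id: "filterlim (\<lambda>x. inf \<bar>x\<bar> \<bar>s\<bar>) (nhdsin \<tau>F 0) ?N" if "s \<in> S" for s
    using filterlim_ident[of ?N] that by (simp add: filterlim_unbounded_filter)
  then show "filterlim uminus ?N ?N"
    by (simp add: filterlim_unbounded_filter)
  show "filterlim (\<lambda>(x, y). x + y) ?N (?N \<times>\<^sub>F ?N)"
    unfolding filterlim_unbounded_filter
  proof
    fix s assume s: "s \<in> S"
    have "filterlim fst ?N (?N \<times>\<^sub>F ?N)" "filterlim snd ?N (?N \<times>\<^sub>F ?N)"
      by (simp_all add: filterlim_def filtermap_fst_prod_filter filtermap_snd_prod_filter)
    with s have
      "filterlim (\<lambda>z. inf \<bar>fst z\<bar> \<bar>s\<bar>) (nhdsin \<tau>F 0) (?N \<times>\<^sub>F ?N)"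
      "filterlim (\<lambda>z. inf \<bar>snd z\<bar> \<bar>s\<bar>) (nhdsin \<tau>F 0) (?N \<times>\<^sub>F ?N)"
      by (simp_all add: filterlim_unbounded_filter)
    then show "filterlim (\<lambda>z. inf \<bar>case z of (x, y) \<Rightarrow> x + y\<bar> \<bar>s\<bar>) (nhdsin \<tau>F 0) (?N \<times>\<^sub>F ?N)"
      by (rule filterlim_inf_abs_add)
        (use s S F in \<open>auto simp: inf_abs_add_le inf_abs_in_order_ideal case_prod_unfold\<close>)
  qed
qed

lemma ex1_unbounded_topology: "\<exists>!\<tau>. is_unbounded_topology \<tau>F S \<tau>"
proof (rule ex_ex1I)
  \<comment> \<open>Translation by 0 is the identity, so the constructed topology has exactly the
    given filter at 0.\<close>
  have "(+) (0 :: 'a) = (\<lambda>x. x)"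
    by auto
  then  show "\<exists>\<tau>. is_unbounded_topology \<tau>F S \<tau>"
    using group_filter_unbounded_filter zero_in_topspace_ideal
    by (intro exI[of _ "group_filter_topology (unbounded_filter \<tau>F S)"])
      (simp add: is_unbounded_topology_iff additive_topology_on_group_filter_topology
        nhdsin_group_filter_topology filtermap_ident)
  fix \<tau> \<sigma> assume "is_unbounded_topology \<tau>F S \<tau>" "is_unbounded_topology \<tau>F S \<sigma>"
  then show "\<tau> = \<sigma>"
    using zero_in_topspace_ideal
    by (simp add: topology_eq is_unbounded_topology_iff
        openin_additive_topology_iff[OF subspace_UNIV])
qed

lemma filterlim_unbounded_filter_generated_ideal:
  "filterlim f (unbounded_filter \<tau>F (generated_ideal S)) H \<longleftrightarrow>
    filterlim f (unbounded_filter \<tau>F S) H"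
proof
  assume "filterlim f (unbounded_filter \<tau>F (generated_ideal S)) H"
  then show "filterlim f (unbounded_filter \<tau>F S) H"
    using hull_subset[of S order_ideal] by (auto simp: filterlim_unbounded_filter)
next
  assume lim: "filterlim f (unbounded_filter \<tau>F S) H"
  \<comment> \<open>For the fixed \<open>f\<close> and \<open>H\<close>, the aim is an ideal
    containing \<open>S\<close>; by minimality of the hull it then contains the generated
    ideal.\<close>
  define J where "J = {y \<in> F. filterlim (\<lambda>z. inf \<bar>f z\<bar> \<bar>y\<bar>) (nhdsin \<tau>F 0) H}"
  have "order_ideal J"
  proof (rule order_idealI)
    show "0 \<in> J"
      using filterlim_zero_ideal subspace_0[OF subspace_ideal] by (simp add: J_def inf_absorb2)
  next
    fix x y assume xy: "x \<in> J" "y \<in> J"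
    then have "x + y \<in> F"
      by (auto simp: J_def intro: subspace_add subspace_ideal)
    \<comment> \<open>By commutativity of \<open>inf\<close>, truncation is subadditive in the
      truncating element as well.\<close>
    have le: "inf \<bar>f z\<bar> \<bar>x + y\<bar> \<le> (inf \<bar>f z\<bar> \<bar>x\<bar>) + (inf \<bar>f z\<bar> \<bar>y\<bar>)" for z
      using inf_abs_add_le[of x y "f z"] by (simp add: inf_commute)
    have "filterlim (\<lambda>z. inf \<bar>f z\<bar> \<bar>x + y\<bar>) (nhdsin \<tau>F 0) H"
      by (rule filterlim_inf_abs_add[of f "\<lambda>_. x" _ f "\<lambda>_. y"])
        (use xy \<open>x + y \<in> F\<close> F le in \<open>auto simp: J_def inf_abs_in_order_ideal\<close>)
    with \<open>x + y \<in> F\<close> show "x + y \<in> J"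
      by (simp add: J_def)
  next
    fix x y assume x: "x \<in> J" and yx: "\<bar>y\<bar> \<le> \<bar>x\<bar>"
    then have y: "y \<in> F"
      using F order_ideal_solid by (auto simp: J_def)
    have "filterlim (\<lambda>z. inf \<bar>f z\<bar> \<bar>y\<bar>) (nhdsin \<tau>F 0) H"
      by (rule filterlim_nhdsin_dominated[OF \<tau>F, of "\<lambda>z. inf \<bar>f z\<bar> \<bar>x\<bar>"])
        (use x y yx F in \<open>auto simp: J_def inf_abs_in_order_ideal intro: le_infI2
          intro!: always_eventually\<close>)
    with y show "y \<in> J"
      by (simp add: J_def)
  qed
  moreover have "S \<subseteq> J"
    using lim S by (auto simp: J_def filterlim_unbounded_filter)
  ultimately have "generated_ideal S \<subseteq> J"
    by (rule hull_minimal[rotated])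
  then show "filterlim f (unbounded_filter \<tau>F (generated_ideal S)) H"
    by (auto simp: filterlim_unbounded_filter J_def)
qed

text \<open>Truncation by \<bar>s\<bar> is monotone, so the squeeze principle passes from
  \<open>F\<close> to the whole space. Local solidity and the bounds on scalar multiples rest on
  this.\<close>

lemma filterlim_unbounded_filter_dominated:
  assumes "filterlim f (unbounded_filter \<tau>F S) H" "eventually (\<lambda>z. \<bar>g z\<bar> \<le> \<bar>f z\<bar>) H"
  shows "filterlim g (unbounded_filter \<tau>F S) H"
  unfolding filterlim_unbounded_filter
proof
  fix s assume s: "s \<in> S"
  show "filterlim (\<lambda>z. inf \<bar>g z\<bar> \<bar>s\<bar>) (nhdsin \<tau>F 0) H"
  proof (rule filterlim_nhdsin_dominated[OF \<tau>F])
    show "filterlim (\<lambda>z. inf \<bar>f z\<bar> \<bar>s\<bar>) (nhdsin \<tau>F 0) H"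
      using assms(1) s by (simp add: filterlim_unbounded_filter)
    show "eventually (\<lambda>z. inf \<bar>g z\<bar> \<bar>s\<bar> \<in> F \<and> \<bar>inf \<bar>g z\<bar> \<bar>s\<bar>\<bar> \<le> \<bar>inf \<bar>f z\<bar> \<bar>s\<bar>\<bar>) H"
      using assms(2)
      by (rule eventually_mono) (use s S F in \<open>auto simp: inf_abs_in_order_ideal intro: le_infI1\<close>)
  qed
qed

lemma filterlim_nhdsin_imp_unbounded_filter:
  assumes "filterlim f (nhdsin \<tau>F 0) H"
  shows "filterlim f (unbounded_filter \<tau>F S) H"
  unfolding filterlim_unbounded_filter
proof
  fix s assume "s \<in> S"
  then show "filterlim (\<lambda>z. inf \<bar>f z\<bar> \<bar>s\<bar>) (nhdsin \<tau>F 0) H"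
    using S F by (intro filterlim_nhdsin_dominated[OF \<tau>F assms])
      (auto simp: inf_abs_in_order_ideal)
qed

section \<open>Continuity of the inclusion, local solidity, separation and linearity\<close>

context
  fixes \<tau> :: "'a topology"
  assumes additive: "additive_topology_on UNIV \<tau>"
    and nhdsin: "nhdsin \<tau> 0 = unbounded_filter \<tau>F S"
begin

lemma continuous_map_inclusion: "continuous_map \<tau>F \<tau> (\<lambda>x. x)"
  unfolding continuous_map_iff_filterlim
proof (intro ballI conjI)
  fix a assume "a \<in> topspace \<tau>F"
  then have "a \<in> F"
    using additive_topology_on_ideal by (simp add: additive_topology_on_def)
  then have "filterlim (\<lambda>x. x - a) (nhdsin \<tau>F 0) (nhdsin \<tau>F a)"
    using filterlim_nhdsin_iff_diff[OF subspace_ideal additive_topology_on_ideal, of a "\<lambda>x. x" "nhdsin \<tau>F a"]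
    by (simp add: filterlim_ident)
  then show "filterlim (\<lambda>x. x) (nhdsin \<tau> a) (nhdsin \<tau>F a)"
    by (simp add: filterlim_nhdsin_iff_diff[OF subspace_UNIV additive] nhdsin
        filterlim_nhdsin_imp_unbounded_filter)
  show "a \<in> topspace \<tau>"
    using additive by (simp add: additive_topology_on_def)
qed

lemma locally_solid_unbounded_topology: "locally_solid_additive_topology_on UNIV \<tau>"
  by (rule locally_solid_additive_topology_onI[OF _ additive])
    (auto simp: nhdsin intro!: filterlim_unbounded_filter_dominated[OF filterlim_ident])

lemma Hausdorff_unbounded_topology_iff:
  "Hausdorff_space \<tau> \<longleftrightarrow> Hausdorff_space \<tau>F \<and> order_dense (generated_ideal S)"
proof -
  let ?I = "generated_ideal S"
  have I: "order_ideal ?I" "?I \<subseteq> F"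
    using order_ideal_generated_ideal hull_minimal[of S F order_ideal] S F by blast+
  \<comment> \<open>The criterion is stated with the generated ideal in place of \<open>S\<close>,
    since order density concerns the ideal.\<close>
  have \<tau>: "Hausdorff_space \<tau> \<longleftrightarrow>
      (\<forall>x. (\<forall>y\<in>?I. filterlim (\<lambda>_::unit. inf \<bar>x\<bar> \<bar>y\<bar>) (nhdsin \<tau>F 0) top) \<longrightarrow> x = 0)"
    by (simp add: Hausdorff_additive_topology_iff[OF subspace_UNIV additive] nhdsin
        flip: filterlim_unbounded_filter filterlim_unbounded_filter_generated_ideal)
  note HF = Hausdorff_additive_topology_iff[OF subspace_ideal additive_topology_on_ideal]
  show ?thesis
  proof
    assume H: "Hausdorff_space \<tau>"
    have "Hausdorff_space \<tau>F"
      unfolding HF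
    proof (intro ballI impI)
      fix x assume "filterlim (\<lambda>_::unit. x) (nhdsin \<tau>F 0) top"
      then have "filterlim (\<lambda>_::unit. x) (nhdsin \<tau> 0) top"
        by (simp add: nhdsin filterlim_nhdsin_imp_unbounded_filter)
      with H show "x = 0"
        by (simp add: Hausdorff_additive_topology_iff[OF subspace_UNIV additive])
    qed
    moreover have "order_dense ?I"
      unfolding order_dense_def
    proof (intro allI impI)
      fix x :: 'a assume x: "x > 0"
      \<comment> \<open>Were x disjoint from the ideal, all its truncations would be 0 and x would
        lie in every neighbourhood of 0. A nonzero truncation is the element of the ideal below
        x.\<close>
      have "\<exists>y\<in>?I. inf \<bar>x\<bar> \<bar>y\<bar> \<noteq> 0"
      proof (rule ccontr)
        assume "\<not> (\<exists>y\<in>?I. inf \<bar>x\<bar> \<bar>y\<bar> \<noteq> 0)"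
        then have "\<forall>y\<in>?I. filterlim (\<lambda>_::unit. inf \<bar>x\<bar> \<bar>y\<bar>) (nhdsin \<tau>F 0) top"
          using filterlim_zero_ideal by auto
        with H x show False
          unfolding \<tau> by blast
      qed
      then obtain y where y: "y \<in> ?I" "inf \<bar>x\<bar> \<bar>y\<bar> \<noteq> 0"
        by blast
      have "0 \<le> inf \<bar>x\<bar> \<bar>y\<bar>" "inf \<bar>x\<bar> \<bar>y\<bar> \<le> \<bar>x\<bar>"
        by simp_all
      with x y have "0 < inf \<bar>x\<bar> \<bar>y\<bar>" "inf \<bar>x\<bar> \<bar>y\<bar> \<le> x"
        by (simp_all add: less_le)
      with inf_abs_in_order_ideal[OF I(1) y(1)] show "\<exists>y\<in>?I. 0 < y \<and> y \<le> x"
        by blast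
    qed
    ultimately show "Hausdorff_space \<tau>F \<and> order_dense ?I" ..
  next
    assume H: "Hausdorff_space \<tau>F \<and> order_dense ?I"
    show "Hausdorff_space \<tau>"
      unfolding \<tau>
    proof (intro allI impI, rule ccontr)
      fix x assume lim: "\<forall>y\<in>?I. filterlim (\<lambda>_::unit. inf \<bar>x\<bar> \<bar>y\<bar>) (nhdsin \<tau>F 0) top"
        and "x \<noteq> 0"
      then have "0 < \<bar>x\<bar>"
        by simp
      with H obtain y where y: "y \<in> ?I" "0 < y" "y \<le> \<bar>x\<bar>"
        unfolding order_dense_def by blast
      \<comment> \<open>As y lies below \<bar>x\<bar>, truncation returns y itself, so a nonzero y
        lies in every neighbourhood of 0 in \<open>F\<close>.\<close>
      then have "inf \<bar>x\<bar> \<bar>y\<bar> = y"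
        by (simp add: inf_absorb2)
      with lim y(1) have "filterlim (\<lambda>_::unit. y) (nhdsin \<tau>F 0) top"
        by metis
      with H y I(2) show False
        unfolding HF by auto
    qed
  qed
qed

lemma linear_unbounded_topology_iff:
  "linear_topology_on UNIV \<tau> \<longleftrightarrow>
    (\<forall>x. filterlim (\<lambda>\<epsilon>::real. \<epsilon> *\<^sub>R x) (unbounded_filter \<tau>F S) (at 0))"
proof
  have top: "topspace \<tau> = UNIV"
    using additive by (simp add: additive_topology_on_def)
  note nhdsin_prod = nhdsin_prod_topology[of _ euclideanreal _ \<tau>, simplified top nhdsin_euclidean,
      simplified]
  {
    assume "linear_topology_on UNIV \<tau>"
    then have "filterlim (\<lambda>(c, x). c *\<^sub>R x) (nhdsin \<tau> 0) (nhds 0 \<times>\<^sub>F nhdsin \<tau> x)" for x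
      by (auto simp: linear_topology_on_def continuous_map_iff_filterlim nhdsin_prod)
        (metis scaleR_zero_left)
    \<comment> \<open>Joint continuity at (0, x) is restricted to the line of pairs with second
      entry x.\<close>
    moreover have "filterlim (\<lambda>\<epsilon>. (\<epsilon>, x)) (nhds 0 \<times>\<^sub>F nhdsin \<tau> x) (at (0::real))" for x
      by (intro filterlim_Pair filterlim_const_nhdsin[OF subspace_UNIV additive]
          tendsto_ident_at) simp
    ultimately show "\<forall>x. filterlim (\<lambda>\<epsilon>::real. \<epsilon> *\<^sub>R x) (unbounded_filter \<tau>F S) (at 0)"
      unfolding nhdsin[symmetric] using filterlim_compose by fastforce
  }
  assume lim: "\<forall>x. filterlim (\<lambda>\<epsilon>::real. \<epsilon> *\<^sub>R x) (unbounded_filter \<tau>F S) (at 0)"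
  have "filterlim (\<lambda>(c, x). c *\<^sub>R x) (nhdsin \<tau> (d *\<^sub>R a)) (nhds d \<times>\<^sub>F nhdsin \<tau> a)" for d a
  proof -
    let ?H = "nhds d \<times>\<^sub>F nhdsin \<tau> a"
    have fst: "filterlim fst (nhds d) ?H" and snd: "filterlim snd (nhdsin \<tau> a) ?H"
      by (simp_all add: filterlim_def filtermap_fst_prod_filter filtermap_snd_prod_filter)
    \<comment> \<open>The strict bound persists for scalars near \<open>d\<close>, so the product
      with \<open>snd z - a\<close> is dominated by a natural multiple of
      \<open>snd z - a\<close>.\<close>
    obtain n where n: "\<bar>d\<bar> < real n"
      using reals_Archimedean2 by blast
    have "eventually (\<lambda>z. \<bar>fst z\<bar> < real n) ?H"
      using tendsto_rabs[OF fst] n by (rule order_tendstoD)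
    moreover have "filterlim (\<lambda>z. real n *\<^sub>R (snd z - a)) (unbounded_filter \<tau>F S) ?H"
      using snd filterlim_scaleR_nat_nhdsin[OF subspace_UNIV additive, of "\<lambda>z. snd z - a" ?H n]
      by (simp add: filterlim_nhdsin_iff_diff[OF subspace_UNIV additive, of a] nhdsin)
    ultimately have "filterlim (\<lambda>z. fst z *\<^sub>R (snd z - a)) (nhdsin \<tau> 0) ?H"
      unfolding nhdsin
      by (elim filterlim_unbounded_filter_dominated eventually_mono) (auto intro!: abs_scaleR_mono)
    moreover have "filterlim (\<lambda>z. (fst z - d) *\<^sub>R a) (nhdsin \<tau> 0) ?H"
    proof -
      \<comment> \<open>The limit in \<open>lim\<close> omits \<epsilon> = 0. It extends to
        \<open>nhds 0\<close> because the value there is 0, which lies in every neighbourhood of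
        0.\<close>
      have "filterlim (\<lambda>\<epsilon>::real. \<epsilon> *\<^sub>R a) (nhdsin \<tau> 0) (nhds 0)"
      proof -
        have "eventually P (nhdsin \<tau> 0) \<Longrightarrow> P 0" for P
          using top by (auto simp: eventually_nhdsin)
        with lim show ?thesis
          by (auto simp: filterlim_iff eventually_nhds_conv_at nhdsin)
      qed
      moreover have "filterlim (\<lambda>z. fst z - d) (nhds 0) ?H"
        using tendsto_diff[OF fst tendsto_const[of d]] by simp
      ultimately show ?thesis
        by (rule filterlim_compose)
    qed
    ultimately have "filterlim (\<lambda>z. fst z *\<^sub>R (snd z - a) + (fst z - d) *\<^sub>R a) (nhdsin \<tau> (0 + 0)) ?H"
      by (rule filterlim_add_nhdsin[OF subspace_UNIV additive]) auto
    then show ?thesis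
      by (subst filterlim_nhdsin_iff_diff[OF subspace_UNIV additive])
        (auto simp: case_prod_unfold algebra_simps)
  qed
  then show "linear_topology_on UNIV \<tau>"
    using additive
    by (auto simp: linear_topology_on_def additive_topology_on_def nhdsin_prod
        continuous_map_iff_filterlim[of "prod_topology euclideanreal \<tau>"])
qed

end

end

theorem theorem3p1:
  fixes F S :: "'a::archimedean_vector_lattice set"
    and \<tau>F :: "'a topology"
  assumes "order_ideal F"
    and "locally_solid_additive_topology_on F \<tau>F"
    and "S \<subseteq> F" and "S \<noteq> {}"
  shows "(\<exists>!\<tau>. is_unbounded_topology \<tau>F S \<tau>) \<and>
    (\<forall>\<tau>. is_unbounded_topology \<tau>F S \<tau> \<longrightarrow>
      (\<forall>(A :: 'i set) le (x :: 'i \<Rightarrow> 'a). directed_set A le \<longrightarrow>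
        (limitin \<tau> x 0 (tails A le) \<longleftrightarrow>
         (\<forall>s\<in>S. limitin \<tau>F (\<lambda>\<alpha>. inf \<bar>x \<alpha>\<bar> \<bar>s\<bar>) 0 (tails A le)))) \<and>
      (\<forall>(A :: 'i set) le (x :: 'i \<Rightarrow> 'a). directed_set A le \<longrightarrow>
        (limitin \<tau> x 0 (tails A le) \<longleftrightarrow>
         (\<forall>y\<in>generated_ideal S. limitin \<tau>F (\<lambda>\<alpha>. inf \<bar>x \<alpha>\<bar> \<bar>y\<bar>) 0 (tails A le)))) \<and>
      continuous_map \<tau>F \<tau> (\<lambda>x. x) \<and>
      locally_solid_additive_topology_on UNIV \<tau> \<and>
      (Hausdorff_space \<tau> \<longleftrightarrow> Hausdorff_space \<tau>F \<and> order_dense (generated_ideal S)) \<and>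
      ((\<forall>x. \<forall>s\<in>S. limitin \<tau>F (\<lambda>\<epsilon>::real. inf \<bar>\<epsilon> *\<^sub>R x\<bar> \<bar>s\<bar>) 0 (at 0)) \<longleftrightarrow>
       (\<forall>x. \<forall>y\<in>generated_ideal S. limitin \<tau>F (\<lambda>\<epsilon>::real. inf \<bar>\<epsilon> *\<^sub>R x\<bar> \<bar>y\<bar>) 0 (at 0))) \<and>
      ((\<forall>x. \<forall>y\<in>generated_ideal S. limitin \<tau>F (\<lambda>\<epsilon>::real. inf \<bar>\<epsilon> *\<^sub>R x\<bar> \<bar>y\<bar>) 0 (at 0)) \<longleftrightarrow>
       linear_topology_on UNIV \<tau>))"
proof -
  note prems = assms(1-3)
  have top: "0 \<in> topspace \<tau>" if "additive_topology_on UNIV \<tau>" for \<tau> :: "'a topology"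
    using that by (simp add: additive_topology_on_def)
  show ?thesis
    \<comment> \<open>All convergence conditions, for \<open>S\<close> or its ideal, become limits
      along one filter, which is the neighbourhood filter of 0 of \<tau>; the claims for nets over
      any index type are then immediate.\<close>
    unfolding limitin_iff_unbounded_filter[OF prems] filterlim_unbounded_filter_generated_ideal[OF prems]
      is_unbounded_topology_iff[OF zero_in_topspace_ideal[OF prems]]
    using ex1_unbounded_topology[OF prems] continuous_map_inclusion[OF prems]
      locally_solid_unbounded_topology[OF prems] Hausdorff_unbounded_topology_iff[OF prems]
      linear_unbounded_topology_iff[OF prems]
    by (simp add: limitin_iff_filterlim_nhdsin top
        is_unbounded_topology_iff[OF zero_in_topspace_ideal[OF prems]])
qed

end
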